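(* For every integer $n\ge 4$ with $n\equiv 4\pmod 8$, there is no whirling knight's tour on the $n\times n$ board whose coil count is $c=n/2$.
   Context: Let $n$ be a positive even integer. The cells of the $n\times n$ board are the integer pairs $(i,j)$ with $0\le i,j\le n-1$, where $i$ is the row index (counted from the top) and $j$ the column index (counted from the left); each cell is identified with the point $(i,j)$ of the plane. The pivot is the point $(p,q)=\bigl(\tfrac{n-1}{2},\tfrac{n-1}{2}\bigr)$, the centre of the board. The whirling-knight digraph on the board has vertex set $V=\{0,\dots,n-1\}^2$ and has an arc $(i,j)\to(i',j')$ exactly when $(i-i')^2+(j-j')^2=5$ (a knight step) and the step is counter-clockwise (CCW) about the pivot, meaning $$(i-p)(j'-q) > (i'-p)(j-q).$$ A whirling knight's tour on the $n\times n$ board is a Hamiltonian directed cycle in this digraph. The north plumb-line is the open ray $\{(x,q): x<p\}$ (first coordinate is the row coordinate). An arc crosses the north plumb-line if the straight segment joining its two endpoint cells meets this ray. The coil count $c$ of a whirling tour is the number of its arcs that cross the north plumb-line (equivalently, the winding number of the cycle about the pivot). *)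

theory Defs
  imports
    "HOL-Analysis.Analysis"
    "HOL-Number_Theory.Cong"
    "Graph_Theory.Arc_Walk"
begin

(* A cell is (row, column), with rows counted from the top and columns from the left. *)
type_synonym cell = "int \<times> int"

definition board :: "nat \<Rightarrow> cell set" where
  "board n = {0..int n - 1} \<times> {0..int n - 1}"

(* First coordinate: row, growing downwards.  Second coordinate: column, growing to the right. *)
definition cell_point :: "cell \<Rightarrow> real \<times> real" where
  "cell_point c = (real_of_int (fst c), real_of_int (snd c))"

definition pivot :: "nat \<Rightarrow> real \<times> real" where
  "pivot n = ((real n - 1) / 2, (real n - 1) / 2)"

definition knight_step :: "cell \<Rightarrow> cell \<Rightarrow> bool" where
  "knight_step u v \<longleftrightarrow> (fst u - fst v)\<^sup>2 + (snd u - snd v)\<^sup>2 = 5"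

(* Since rows grow downwards, a positive determinant means counter-clockwise as the board is seen. *)
definition ccw_step :: "nat \<Rightarrow> cell \<Rightarrow> cell \<Rightarrow> bool" where
  "ccw_step n u v \<longleftrightarrow>
     (fst (cell_point u) - fst (pivot n)) * (snd (cell_point v) - snd (pivot n))
       > (fst (cell_point v) - fst (pivot n)) * (snd (cell_point u) - snd (pivot n))"

definition whirling_knight_digraph :: "nat \<Rightarrow> (cell, cell \<times> cell) pre_digraph" where
  "whirling_knight_digraph n =
     \<lparr> verts = board n,
       arcs = {(u, v). u \<in> board n \<and> v \<in> board n \<and> knight_step u v \<and> ccw_step n u v},
       tail = fst,
       head = snd \<rparr>"

(* The cycle predicate of Graph_Theory already says: closed, nonempty, no repeated vertex.
   In a closed walk the visited vertices are exactly the tails of its arcs. *)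
definition (in pre_digraph) hamiltonian_cycle :: "'b awalk \<Rightarrow> bool" where
  "hamiltonian_cycle p \<longleftrightarrow> cycle p \<and> tail G ` set p = verts G"

definition whirling_tour :: "nat \<Rightarrow> (cell \<times> cell) list \<Rightarrow> bool" where
  "whirling_tour n p \<longleftrightarrow> pre_digraph.hamiltonian_cycle (whirling_knight_digraph n) p"

definition north_plumb_line :: "nat \<Rightarrow> (real \<times> real) set" where
  "north_plumb_line n = {(x, y). x < fst (pivot n) \<and> y = snd (pivot n)}"

definition crosses_north :: "nat \<Rightarrow> cell \<times> cell \<Rightarrow> bool" where
  "crosses_north n a \<longleftrightarrow>
     closed_segment (cell_point (fst a)) (cell_point (snd a)) \<inter> north_plumb_line n \<noteq> {}"

(* Counting the set of arcs is enough: the arcs of a cycle are pairwise distinct. *)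
definition coil_count :: "nat \<Rightarrow> (cell \<times> cell) list \<Rightarrow> nat" where
  "coil_count n p = card {a \<in> set p. crosses_north n a}"

end

theory Submission
  imports Defs
begin

text \<open>
  Write \<open>n = 4 * k\<close> with \<open>k\<close> odd, and colour the cell \<open>(i, j)\<close> by the parity of \<open>i + j\<close>. Knight steps
  alternate the colours, so the arcs crossing a ray from the pivot split into those that leave an even
  cell and those that leave an odd one. Both kinds turn out to occur at least \<open>k + 1\<close> times on the
  north plumb-line, so the coil count is at least \<open>2 * k + 2 = n div 2 + 2\<close>. Both bounds come from
  counting the arcs of a tour at their end points: exactly one leaves and one enters each cell.

  Even tails (\<open>card_even_north_arcs\<close>). Consider the cells in even rows of the northern halves of the
  two central columns, \<open>k\<close> in each column. The cells of the right column are even, and from each of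
  them every available arc crosses the plumb-line; the cells of the left column are odd, and every arc
  into one of them crosses the plumb-line as well, from an even tail. With only \<open>k\<close> crossings from
  even tails, these would match the \<open>k\<close> right cells with the \<open>k\<close> left cells, each time changing
  the row by \<open>2\<close> up or down. The row changes of such a matching add up to \<open>0\<close>, whereas a sum of
  \<open>k\<close> terms \<open>\<plusminus>2\<close> is \<open>2\<close> modulo \<open>4\<close> when \<open>k\<close> is odd.

  Odd tails. A quarter turn about the pivot exchanges the two colours because \<open>n\<close> is even, so
  the same bound holds for arcs with odd tail across the east ray (\<open>card_odd_east_arcs\<close>). Between
  the two rays lies the north-east quadrant. It has as many even as odd cells; each of its odd cells
  is the tail of one arc with odd tail and each of its even cells is the head of one. Hence
  as many arcs with odd tail leave the quadrant as enter it, which makes their numbers across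
  the two rays equal (\<open>odd_north_eq_odd_east\<close>).
\<close>

section \<open>Arcs of the whirling-knight digraph\<close>

definition whirling_arc :: "nat \<Rightarrow> cell \<Rightarrow> cell \<Rightarrow> bool" where
  "whirling_arc n u v \<longleftrightarrow> u \<in> board n \<and> v \<in> board n \<and> knight_step u v \<and> ccw_step n u v"

lemma ccw_step_iff:
  "ccw_step n (i, j) (i', j') \<longleftrightarrow>
     (2 * i' - int n + 1) * (2 * j - int n + 1) < (2 * i - int n + 1) * (2 * j' - int n + 1)"
proof -
  have half: "real_of_int x - (real n - 1) / 2 = real_of_int (2 * x - int n + 1) / 2" for x
    by (simp add: field_simps)
  have "ccw_step n (i, j) (i', j') \<longleftrightarrow>
      real_of_int ((2 * i' - int n + 1) * (2 * j - int n + 1))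
        < real_of_int ((2 * i - int n + 1) * (2 * j' - int n + 1))"
    unfolding ccw_step_def cell_point_def pivot_def fst_conv snd_conv half by simp
  then show ?thesis
    by (simp only: of_int_less_iff)
qed

lemma knight_step_cases:
  assumes "knight_step (i, j) (i', j')"
  obtains a b where "i' = i + a" "j' = j + b"
    "(a, b) \<in> {(1, 2), (1, -2), (-1, 2), (-1, -2), (2, 1), (2, -1), (-2, 1), (-2, -1)}"
proof -
  define a b where "a = i' - i" and "b = j' - j"
  have eq: "a\<^sup>2 + b\<^sup>2 = 5"
    using assms by (simp add: knight_step_def a_def b_def power2_commute)
  have bound: "\<bar>x\<bar> \<le> 2" if "x\<^sup>2 + y\<^sup>2 = 5" for x y :: int
  proof (rule ccontr)
    assume "\<not> \<bar>x\<bar> \<le> 2"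
    then have "3\<^sup>2 \<le> \<bar>x\<bar>\<^sup>2"
      by (intro power_mono) auto
    with that show False
      using zero_le_power2[of y] by simp
  qed
  have "\<bar>a\<bar> \<le> 2" "\<bar>b\<bar> \<le> 2"
    using bound[of a b] bound[of b a] eq by simp_all
  then have "a \<in> {-2, -1, 0, 1, 2}" "b \<in> {-2, -1, 0, 1, 2}"
    by auto
  moreover have "\<forall>a \<in> {-2, -1, 0, 1, 2}. \<forall>b \<in> {-2, -1, 0, 1, 2 :: int}. a\<^sup>2 + b\<^sup>2 = 5 \<longrightarrow>
      (a, b) \<in> {(1, 2), (1, -2), (-1, 2), (-1, -2), (2, 1), (2, -1), (-2, 1), (-2, -1 :: int)}"
    by simp
  ultimately have "(a, b) \<in> {(1, 2), (1, -2), (-1, 2), (-1, -2), (2, 1), (2, -1), (-2, 1), (-2, -1)}"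
    using eq by blast
  then show thesis
    by (intro that[of a b]) (simp_all add: a_def b_def)
qed

text \<open>
  Because a knight displacement \<open>(a, b)\<close> takes only eight values, turning counter-clockwise is a
  linear condition on the tail once the displacement is known.
\<close>
lemma whirling_arcE:
  assumes "whirling_arc n (i, j) (i', j')"
  obtains a b where "i' = i + a" "j' = j + b"
    "(a, b) \<in> {(1, 2), (1, -2), (-1, 2), (-1, -2), (2, 1), (2, -1), (-2, 1), (-2, -1)}"
    "a * (2 * j - int n + 1) < b * (2 * i - int n + 1)"
    "0 \<le> i" "i < int n" "0 \<le> j" "j < int n" "0 \<le> i'" "i' < int n" "0 \<le> j'" "j' < int n"
proof -
  have "knight_step (i, j) (i', j')" and ccw: "ccw_step n (i, j) (i', j')"
    and bd: "0 \<le> i" "i < int n" "0 \<le> j" "j < int n" "0 \<le> i'" "i' < int n" "0 \<le> j'" "j' < int n"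
    using assms by (auto simp: whirling_arc_def board_def)
  then obtain a b where ab: "i' = i + a" "j' = j + b"
    "(a, b) \<in> {(1, 2), (1, -2), (-1, 2), (-1, -2), (2, 1), (2, -1), (-2, 1), (-2, -1)}"
    by (elim knight_step_cases)
  have "a * (2 * j - int n + 1) < b * (2 * i - int n + 1)"
    using ccw by (simp add: ccw_step_iff ab algebra_simps)
  with ab bd that show thesis
    by blast
qed

lemma whirling_arc_alternates_colour:
  assumes "whirling_arc n u v"
  shows "even (fst v + snd v) \<longleftrightarrow> odd (fst u + snd u)"
proof (cases u; cases v)
  fix i j i' j' assume "u = (i, j)" "v = (i', j')"
  with assms have "whirling_arc n (i, j) (i', j')"
    by simp
  then show ?thesis
    unfolding \<open>u = (i, j)\<close> \<open>v = (i', j')\<close> by (elim whirling_arcE) auto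
qed

text \<open>
  A segment whose end points lie on opposite sides of the central column line meets that line above the
  pivot exactly if it passes the pivot counter-clockwise when traversed from right to left, or clockwise
  from left to right. So for a whirling arc, being such a right-to-left step is the whole condition.
\<close>
lemma crosses_north_iff:
  assumes "even n" "whirling_arc n u v"
  shows "crosses_north n (u, v) \<longleftrightarrow> int n \<le> 2 * snd u \<and> 2 * snd v < int n"
proof -
  obtain i j i' j' where uv: "u = (i, j)" "v = (i', j')"
    by (cases u; cases v)
  \<comment> \<open>Coordinates relative to the pivot, doubled to be odd integers; so none of them vanishes.\<close>
  define x y x' y' where xy: "x = real_of_int (2 * i - int n + 1)" "y = real_of_int (2 * j - int n + 1)"
    "x' = real_of_int (2 * i' - int n + 1)" "y' = real_of_int (2 * j' - int n + 1)"
  have ccw: "x' * y < x * y'"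
    using assms(2) unfolding whirling_arc_def uv ccw_step_iff xy
    by (simp only: of_int_mult[symmetric] of_int_less_iff)
  have nz: "y \<noteq> 0" "y' \<noteq> 0"
    using assms(1) unfolding xy of_int_eq_0_iff by presburger+
  have "crosses_north n (u, v) \<longleftrightarrow>
      (\<exists>t. 0 \<le> t \<and> t \<le> 1 \<and> (1 - t) * x + t * x' < 0 \<and> (1 - t) * y + t * y' = 0)"
  proof -
    have meet: "f ` A \<inter> B \<noteq> {} \<longleftrightarrow> (\<exists>t\<in>A. f t \<in> B)" for f :: "real \<Rightarrow> real \<times> real" and A B
      by blast
    have "crosses_north n (u, v) \<longleftrightarrow>
      (\<exists>t. 0 \<le> t \<and> t \<le> 1 \<and> (1 - t) * real_of_int i + t * real_of_int i' < (real n - 1) / 2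
        \<and> (1 - t) * real_of_int j + t * real_of_int j' = (real n - 1) / 2)"
      unfolding crosses_north_def closed_segment_image_interval meet
      by (simp add: north_plumb_line_def cell_point_def pivot_def uv Bex_def conj_assoc)
    also have "\<dots> \<longleftrightarrow> (\<exists>t. 0 \<le> t \<and> t \<le> 1 \<and> (1 - t) * x + t * x' < 0 \<and> (1 - t) * y + t * y' = 0)"
      unfolding xy by (intro ex_cong1 conj_cong refl) (auto simp: field_simps)
    finally show ?thesis .
  qed
  also have "\<dots> \<longleftrightarrow> 0 < y \<and> y' < 0"
  proof
    assume "\<exists>t. 0 \<le> t \<and> t \<le> 1 \<and> (1 - t) * x + t * x' < 0 \<and> (1 - t) * y + t * y' = 0"
    then obtain t where t: "0 \<le> t" "t \<le> 1" "(1 - t) * x + t * x' < 0" "(1 - t) * y + t * y' = 0"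
      by blast
    have pos: "0 < t" "t < 1"
      using t nz by (auto simp: order.order_iff_strict)
    have "y * ((1 - t) * x + t * x') = t * (x' * y - x * y') + x * ((1 - t) * y + t * y')"
      by (simp add: algebra_simps)
    also have "\<dots> < 0"
      using ccw pos by (simp add: t(4) mult_less_0_iff)
    finally have "0 < y"
      using t(3) by (auto simp: mult_less_0_iff)
    moreover have "t * y' = - ((1 - t) * y)"
      using t(4) by simp
    then have "t * y' < 0"
      using pos \<open>0 < y\<close> by simp
    then have "y' < 0"
      using pos by (simp add: mult_less_0_iff)
    ultimately show "0 < y \<and> y' < 0" ..
  next
    assume y: "0 < y \<and> y' < 0"
    define t where "t = y / (y - y')"
    have t': "1 - t = - y' / (y - y')"
      using y by (simp add: t_def field_simps)
    have "(1 - t) * y + t * y' = 0" "(1 - t) * x + t * x' = (x' * y - x * y') / (y - y')"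
      unfolding t' by (simp_all add: t_def diff_divide_distrib mult.commute)
    moreover have "(x' * y - x * y') / (y - y') < 0"
      using ccw y by (intro divide_neg_pos) auto
    moreover have "0 \<le> t" "t \<le> 1"
      using y by (simp_all add: t_def field_simps)
    ultimately show "\<exists>t. 0 \<le> t \<and> t \<le> 1 \<and> (1 - t) * x + t * x' < 0 \<and> (1 - t) * y + t * y' = 0"
      by (intro exI[of _ t]) simp
  qed
  also have "\<dots> \<longleftrightarrow> int n \<le> 2 * snd u \<and> 2 * snd v < int n"
    using assms(1) unfolding xy uv of_int_0_less_iff of_int_less_0_iff fst_conv snd_conv by presburger
  finally show ?thesis .
qed

section \<open>Cycle covers\<close>

text \<open>
  The proof counts the arcs leaving and entering each cell, so the arc set of a tour is treated as a
  cycle cover: a vertex-disjoint union of whirling cycles through all cells. For such arc sets,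
  invariance under rotation of the board is immediate.
\<close>
definition whirling_cover :: "nat \<Rightarrow> (cell \<times> cell) set \<Rightarrow> bool" where
  "whirling_cover n P \<longleftrightarrow> (\<forall>(u, v) \<in> P. whirling_arc n u v)
     \<and> bij_betw fst P (board n) \<and> bij_betw snd P (board n)"

text \<open>
  The inner vertices of a walk are both heads and tails. For a closed walk the two multisets therefore
  agree, which transfers distinctness from the heads, where the definition of a cycle puts it, to the
  tails.
\<close>
lemma (in pre_digraph) tails_heads_of_cas:
  assumes "cas u p v"
  shows "mset (map (tail G) p) + {#v#} = mset (map (head G) p) + {#u#}"
  using assms by (induction p arbitrary: u) (auto simp: add_mset_commute)

lemma (in pre_digraph) tl_awalk_verts_of_cas:
  assumes "cas u p v"
  shows "tl (awalk_verts u p) = map (head G) p"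
proof -
  have "awalk_verts u p = u # map (head G) p"
    using assms by (induction p arbitrary: u) auto
  then show ?thesis
    by simp
qed

lemma (in pre_digraph) hamiltonian_cycle_bij_betw:
  assumes "hamiltonian_cycle p"
  shows "set p \<subseteq> arcs G" "bij_betw (tail G) (set p) (verts G)" "bij_betw (head G) (set p) (verts G)"
proof -
  obtain u where cas: "cas u p u" and sub: "set p \<subseteq> arcs G"
    and dist: "distinct (tl (awalk_verts u p))" and img: "tail G ` set p = verts G"
    using assms by (auto simp: hamiltonian_cycle_def cycle_def awalk_def)
  have meq: "mset (map (tail G) p) = mset (map (head G) p)"
    using tails_heads_of_cas[OF cas] by simp
  have dh: "distinct (map (head G) p)"
    using dist tl_awalk_verts_of_cas[OF cas] by simp
  then have dt: "distinct (map (tail G) p)"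
    using mset_eq_imp_distinct_iff[OF meq] by simp
  have "head G ` set p = verts G"
    using mset_eq_setD[OF meq] img by simp
  then show "bij_betw (tail G) (set p) (verts G)" "bij_betw (head G) (set p) (verts G)"
    using img dh dt by (auto simp: bij_betw_def distinct_map)
  show "set p \<subseteq> arcs G"
    by (rule sub)
qed

lemma whirling_tour_cover:
  assumes "whirling_tour n p"
  shows "whirling_cover n (set p)"
proof -
  let ?G = "whirling_knight_digraph n"
  have G: "verts ?G = board n" "arcs ?G = {(u, v). whirling_arc n u v}" "tail ?G = fst" "head ?G = snd"
    by (simp_all add: whirling_knight_digraph_def whirling_arc_def)
  note bij = pre_digraph.hamiltonian_cycle_bij_betw[OF assms[unfolded whirling_tour_def], unfolded G]
  have "\<forall>(u, v) \<in> set p. whirling_arc n u v"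
    using bij(1) by blast
  with bij(2,3) show ?thesis
    unfolding whirling_cover_def by blast
qed

lemma finite_board: "finite (board n)"
  by (simp add: board_def)

lemma whirling_cover_finite:
  assumes "whirling_cover n P"
  shows "finite P"
  using assms finite_board bij_betw_finite unfolding whirling_cover_def by metis

lemma bij_betw_preimage:
  assumes "bij_betw f A B" "S \<subseteq> B"
  shows "bij_betw f {a \<in> A. f a \<in> S} S"
proof (rule bij_betw_subset[OF assms(1)])
  show "f ` {a \<in> A. f a \<in> S} = S"
    using assms unfolding bij_betw_def by blast
qed blast

lemma whirling_cover_bij_betw_tails:
  assumes "whirling_cover n P" "S \<subseteq> board n"
  shows "bij_betw fst {a \<in> P. fst a \<in> S} S"
  using assms by (intro bij_betw_preimage) (simp_all add: whirling_cover_def)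

lemma whirling_cover_bij_betw_heads:
  assumes "whirling_cover n P" "S \<subseteq> board n"
  shows "bij_betw snd {a \<in> P. snd a \<in> S} S"
  using assms by (intro bij_betw_preimage) (simp_all add: whirling_cover_def)

section \<open>Crossings from even cells\<close>

text \<open>
  For whirling arcs this amounts to crossing the north plumb-line, by \<open>crosses_north_iff\<close>; the
  definition after it is the analogue for the ray running east from the pivot.
\<close>
definition north_arcs :: "nat \<Rightarrow> (cell \<times> cell) set \<Rightarrow> (cell \<times> cell) set" where
  "north_arcs n P = {a \<in> P. int n \<le> 2 * snd (fst a) \<and> 2 * snd (snd a) < int n}"

definition east_arcs :: "nat \<Rightarrow> (cell \<times> cell) set \<Rightarrow> (cell \<times> cell) set" where
  "east_arcs n P = {a \<in> P. int n \<le> 2 * fst (fst a) \<and> 2 * fst (snd a) < int n}"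

definition even_tail :: "cell \<times> cell \<Rightarrow> bool" where
  "even_tail a \<longleftrightarrow> even (fst (fst a) + snd (fst a))"

lemma card_even_rows: "card ((\<lambda>t. (2 * int t, c :: int)) ` {..<k}) = k"
  by (subst card_image) (auto simp: inj_on_def)

text \<open>
  Any even number of rows could be matched by pairwise swaps of neighbours; the obstruction is that
  \<open>k\<close> is odd. Even rows keep the argument away from row \<open>2 * k - 1\<close>, next to the pivot, where an arc
  leaving the right cell or entering the left cell may avoid the plumb-line.
\<close>
lemma card_even_north_arcs:
  assumes cover: "whirling_cover n P" and n: "n = 4 * k" and k: "odd k"
  shows "k < card {a \<in> north_arcs n P. even_tail a}"
proof (rule ccontr)
  define F where "F = {a \<in> north_arcs n P. even_tail a}"
  define S where "S c = (\<lambda>t. (2 * int t, c :: int)) ` {..<k}" for c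
  define T where "T = {a \<in> P. fst a \<in> S (2 * int k)}"
  define H where "H = {a \<in> P. snd a \<in> S (2 * int k - 1)}"
  assume "\<not> k < card {a \<in> north_arcs n P. even_tail a}"
  then have cF: "card F \<le> k"
    by (simp add: F_def)
  have fin: "finite F"
    using whirling_cover_finite[OF cover] by (auto simp: F_def north_arcs_def)
  have arc: "whirling_arc n u v" if "(u, v) \<in> P" for u v
    using cover that by (auto simp: whirling_cover_def)
  have "S (2 * int k) \<subseteq> board n" "S (2 * int k - 1) \<subseteq> board n"
    by (auto simp: S_def board_def n)
  then have bT: "bij_betw fst T (S (2 * int k))" and bH: "bij_betw snd H (S (2 * int k - 1))"
    unfolding T_def H_def
    using whirling_cover_bij_betw_tails[OF cover] whirling_cover_bij_betw_heads[OF cover] by blast+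
  have cT: "card T = k" and cH: "card H = k"
    using bij_betw_same_card[OF bT] bij_betw_same_card[OF bH] by (simp_all add: S_def card_even_rows)
  \<comment> \<open>Row \<open>2 * t\<close> is at most \<open>2 * k - 2\<close>, high enough above the pivot for every counter-clockwise
    step from column \<open>2 * k\<close> to go left, and for every one into column \<open>2 * k - 1\<close> to come from the right.\<close>
  have TF: "T \<subseteq> F"
  proof
    fix a assume "a \<in> T"
    then obtain t v where a: "a = ((2 * int t, 2 * int k), v)" "a \<in> P" "t < k"
      by (cases a) (auto simp: T_def S_def)
    obtain i' j' where v: "v = (i', j')"
      by (cases v)
    have "whirling_arc n (2 * int t, 2 * int k) (i', j')"
      using arc a(2) unfolding a(1) v by blast
    then have "j' < 2 * int k"
      using a(3) by (elim whirling_arcE) (auto simp: n)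
    then show "a \<in> F"
      using a by (auto simp: F_def north_arcs_def even_tail_def n v)
  qed
  have HF: "H \<subseteq> F"
  proof
    fix a assume "a \<in> H"
    then obtain t u where a: "a = (u, (2 * int t, 2 * int k - 1))" "a \<in> P" "t < k"
      by (cases a) (auto simp: H_def S_def)
    obtain i j where u: "u = (i, j)"
      by (cases u)
    have w: "whirling_arc n (i, j) (2 * int t, 2 * int k - 1)"
      using arc a(2) unfolding a(1) u by blast
    then have "2 * int k \<le> j"
      using a(3) by (elim whirling_arcE) (auto simp: n)
    moreover have "even (i + j)"
      using whirling_arc_alternates_colour[OF w] by simp
    ultimately show "a \<in> F"
      using a by (auto simp: F_def north_arcs_def even_tail_def n u)
  qed
  have eq: "T = F" "H = F"
    using TF HF cF cT cH fin by (metis card_seteq)+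
  have "(\<Sum>a\<in>F. fst (fst a)) = (\<Sum>t<k. 2 * int t)"
    using sum.reindex_bij_betw[OF bT[unfolded eq], of fst]
    by (simp add: S_def sum.reindex inj_on_def)
  moreover have "(\<Sum>a\<in>F. fst (snd a)) = (\<Sum>t<k. 2 * int t)"
    using sum.reindex_bij_betw[OF bH[unfolded eq], of fst]
    by (simp add: S_def sum.reindex inj_on_def)
  ultimately have zero: "(\<Sum>a\<in>F. fst (snd a) - fst (fst a)) = 0"
    by (simp add: sum_subtractf)
  have step: "(fst (snd a) - fst (fst a)) mod 4 = 2" if "a \<in> F" for a
  proof -
    have "a \<in> T" "a \<in> H"
      using that eq by simp_all
    then obtain s t where a: "a = ((2 * int s, 2 * int k), (2 * int t, 2 * int k - 1))" "a \<in> P"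
      by (cases a) (auto simp: T_def H_def S_def)
    have "whirling_arc n (2 * int s, 2 * int k) (2 * int t, 2 * int k - 1)"
      using arc a by blast
    then have "2 * int t - 2 * int s = 2 \<or> 2 * int t - 2 * int s = - 2"
      by (elim whirling_arcE) auto
    then show ?thesis
      unfolding a by auto
  qed
  have "(\<Sum>a\<in>F. fst (snd a) - fst (fst a)) mod 4 = (\<Sum>a\<in>F. (fst (snd a) - fst (fst a)) mod 4) mod 4"
    by (rule mod_sum_eq[symmetric])
  also have "\<dots> = (2 * int k) mod 4"
    using step cT eq by (simp add: mult.commute)
  also have "\<dots> = 2"
    using k by presburger
  finally show False
    using zero by simp
qed

section \<open>A quarter turn\<close>

text \<open>The counter-clockwise quarter turn about the pivot.\<close>
definition turn :: "nat \<Rightarrow> cell \<Rightarrow> cell" where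
  "turn n u = (int n - 1 - snd u, fst u)"

lemma whirling_arc_turn:
  assumes "whirling_arc n u v"
  shows "whirling_arc n (turn n u) (turn n v)"
  using assms
  by (cases u; cases v)
    (auto simp: whirling_arc_def turn_def board_def knight_step_def ccw_step_iff algebra_simps power2_eq_square)

lemma bij_betw_turn: "bij_betw (turn n) (board n) (board n)"
  by (rule bij_betwI[where g = "\<lambda>u. (snd u, int n - 1 - fst u)"]) (auto simp: turn_def board_def)

lemma inj_turn: "inj (turn n)"
  by (auto simp: inj_def turn_def prod_eq_iff)

lemma whirling_cover_turn:
  assumes "whirling_cover n P"
  shows "whirling_cover n (map_prod (turn n) (turn n) ` P)"
proof -
  have inj: "inj_on (map_prod (turn n) (turn n)) P"
    using inj_turn by (meson prod.inj_map inj_on_subset subset_UNIV)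
  have *: "bij_betw g (map_prod (turn n) (turn n) ` P) (board n)"
    if "bij_betw g P (board n)" "\<And>a. g (map_prod (turn n) (turn n) a) = turn n (g a)" for g
  proof -
    have "bij_betw (g \<circ> map_prod (turn n) (turn n)) P (board n)"
      using bij_betw_trans[OF that(1) bij_betw_turn] by (simp add: comp_def that(2))
    then show ?thesis
      using inj by (metis bij_betw_comp_iff inj_on_imp_bij_betw)
  qed
  have "whirling_arc n (turn n (fst a)) (turn n (snd a))" if "a \<in> P" for a
    using assms that by (intro whirling_arc_turn) (auto simp: whirling_cover_def)
  then have "\<forall>(u, v) \<in> map_prod (turn n) (turn n) ` P. whirling_arc n u v"
    by (simp add: case_prod_unfold)
  then show ?thesis
    using assms *[of fst] *[of snd] unfolding whirling_cover_def by simp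
qed

text \<open>The turn carries the east ray to the north plumb-line and flips the colour of every cell.\<close>
lemma card_odd_east_arcs:
  assumes cover: "whirling_cover n P" and n: "n = 4 * k" and k: "odd k"
  shows "k < card {a \<in> east_arcs n P. \<not> even_tail a}"
proof -
  let ?r = "map_prod (turn n) (turn n)"
  have "{a \<in> north_arcs n (?r ` P). even_tail a} = ?r ` {a \<in> east_arcs n P. \<not> even_tail a}"
    by (force simp: north_arcs_def east_arcs_def even_tail_def turn_def n)
  moreover have "inj_on ?r {a \<in> east_arcs n P. \<not> even_tail a}"
    using inj_turn by (meson prod.inj_map inj_on_subset subset_UNIV)
  ultimately show ?thesis
    using card_even_north_arcs[OF whirling_cover_turn[OF cover] n k] by (simp add: card_image)
qed

section \<open>Colour balance\<close>

definition north_east_quadrant :: "nat \<Rightarrow> cell set" where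
  "north_east_quadrant n = {0..<int n div 2} \<times> {int n div 2..<int n}"

text \<open>
  Counter-clockwise arcs enter the quadrant only across the east ray and leave it only across the north
  ray. An arc from the south-east to the north-west quadrant crosses both rays without touching the
  quadrant, so it adds one to each side.
\<close>
lemma crossing_balance:
  assumes "even n" "whirling_arc n u v"
  shows "of_bool (int n \<le> 2 * snd u \<and> 2 * snd v < int n) + of_bool (v \<in> north_east_quadrant n)
    = (of_bool (int n \<le> 2 * fst u \<and> 2 * fst v < int n) + of_bool (u \<in> north_east_quadrant n) :: nat)"
proof -
  obtain m where n: "n = 2 * m"
    using assms(1) by blast
  obtain i j i' j' where uv: "u = (i, j)" "v = (i', j')"
    by (cases u; cases v)
  show ?thesis
    using assms(2) unfolding uv by (elim whirling_arcE) (auto simp: north_east_quadrant_def n)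
qed

lemma card_quadrant_colours:
  assumes "4 dvd n"
  shows "card {u \<in> north_east_quadrant n. even (fst u + snd u)} = card {u \<in> north_east_quadrant n. odd (fst u + snd u)}"
proof -
  obtain k where n: "n = 4 * k"
    using assms by blast
  \<comment> \<open>Reflect the columns \<open>2 * k, \<dots>, 4 * k - 1\<close> in their middle.\<close>
  define f :: "cell \<Rightarrow> cell" where "f u = (fst u, 6 * int k - 1 - snd u)" for u
  have "bij_betw f {u \<in> north_east_quadrant n. even (fst u + snd u)} {u \<in> north_east_quadrant n. odd (fst u + snd u)}"
    by (rule bij_betwI[where g = f]) (auto simp: f_def north_east_quadrant_def n)
  then show ?thesis
    by (rule bij_betw_same_card)
qed

text \<open>
  Summing \<open>crossing_balance\<close> over the arcs with odd tail: the two quadrant terms count the odd cells of the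
  quadrant as tails and its even cells as heads, and so cancel.
\<close>
lemma odd_north_eq_odd_east:
  assumes cover: "whirling_cover n P" and n: "4 dvd n"
  shows "card {a \<in> north_arcs n P. \<not> even_tail a} = card {a \<in> east_arcs n P. \<not> even_tail a}"
proof -
  have fin: "finite P"
    by (rule whirling_cover_finite[OF cover])
  define D where "D = {a \<in> P. \<not> even_tail a}"
  have finD: "finite D"
    using fin by (simp add: D_def)
  have arc: "whirling_arc n (fst a) (snd a)" if "a \<in> P" for a
    using cover that by (auto simp: whirling_cover_def)
  have sub: "{u \<in> north_east_quadrant n. Q u} \<subseteq> board n" for Q
    by (auto simp: north_east_quadrant_def board_def)
  have "{a \<in> D. fst a \<in> north_east_quadrant n} = {a \<in> P. fst a \<in> {u \<in> north_east_quadrant n. odd (fst u + snd u)}}"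
    by (auto simp: D_def even_tail_def)
  then have tails: "card {a \<in> D. fst a \<in> north_east_quadrant n} = card {u \<in> north_east_quadrant n. odd (fst u + snd u)}"
    using bij_betw_same_card[OF whirling_cover_bij_betw_tails[OF cover sub]] by simp
  have "{a \<in> D. snd a \<in> north_east_quadrant n} = {a \<in> P. snd a \<in> {u \<in> north_east_quadrant n. even (fst u + snd u)}}"
    using whirling_arc_alternates_colour[OF arc] by (auto simp: D_def even_tail_def)
  then have heads: "card {a \<in> D. snd a \<in> north_east_quadrant n} = card {u \<in> north_east_quadrant n. even (fst u + snd u)}"
    using bij_betw_same_card[OF whirling_cover_bij_betw_heads[OF cover sub]] by simp
  have cnt: "card {a \<in> D. Q a} = (\<Sum>a\<in>D. of_bool (Q a))" for Q
    using finD by (simp add: Int_def)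
  have "(\<Sum>a\<in>D. of_bool (int n \<le> 2 * snd (fst a) \<and> 2 * snd (snd a) < int n) + of_bool (snd a \<in> north_east_quadrant n))
      = (\<Sum>a\<in>D. of_bool (int n \<le> 2 * fst (fst a) \<and> 2 * fst (snd a) < int n) + of_bool (fst a \<in> north_east_quadrant n) :: nat)"
    using n by (intro sum.cong refl crossing_balance arc) (auto simp: D_def)
  then have "card {a \<in> D. int n \<le> 2 * snd (fst a) \<and> 2 * snd (snd a) < int n} + card {a \<in> D. snd a \<in> north_east_quadrant n}
      = card {a \<in> D. int n \<le> 2 * fst (fst a) \<and> 2 * fst (snd a) < int n} + card {a \<in> D. fst a \<in> north_east_quadrant n}"
    unfolding cnt sum.distrib .
  then have "card {a \<in> D. int n \<le> 2 * snd (fst a) \<and> 2 * snd (snd a) < int n}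
      = card {a \<in> D. int n \<le> 2 * fst (fst a) \<and> 2 * fst (snd a) < int n}"
    using tails heads card_quadrant_colours[OF n] by simp
  moreover have "{a \<in> D. int n \<le> 2 * snd (fst a) \<and> 2 * snd (snd a) < int n} = {a \<in> north_arcs n P. \<not> even_tail a}"
    "{a \<in> D. int n \<le> 2 * fst (fst a) \<and> 2 * fst (snd a) < int n} = {a \<in> east_arcs n P. \<not> even_tail a}"
    by (auto simp: D_def north_arcs_def east_arcs_def)
  ultimately show ?thesis
    by simp
qed

section \<open>The coil count\<close>

lemma coil_count_ge:
  assumes tour: "whirling_tour n p" and n: "n = 4 * k" and k: "odd k"
  shows "2 * k + 2 \<le> coil_count n p"
proof -
  note cover = whirling_tour_cover[OF tour]
  let ?N = "north_arcs n (set p)"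
  have "{a \<in> set p. crosses_north n a} = ?N"
    using cover crosses_north_iff[of n] n by (auto simp: north_arcs_def whirling_cover_def)
  then have "coil_count n p = card ?N"
    by (simp add: coil_count_def)
  also have "\<dots> = card {a \<in> ?N. even_tail a} + card {a \<in> ?N. \<not> even_tail a}"
    using whirling_cover_finite[OF cover]
    by (subst card_Un_disjoint[symmetric]) (auto simp: north_arcs_def intro!: arg_cong[of _ _ card])
  finally show ?thesis
    using card_even_north_arcs[OF cover n k] card_odd_east_arcs[OF cover n k]
      odd_north_eq_odd_east[OF cover] n by simp
qed

theorem theorem2:
  fixes n :: nat
  assumes "n \<ge> 4" and "[n = 4] (mod 8)"
  shows "\<not> (\<exists>p. whirling_tour n p \<and> coil_count n p = n div 2)"
proof
  assume "\<exists>p. whirling_tour n p \<and> coil_count n p = n div 2"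
  then obtain p where p: "whirling_tour n p" "coil_count n p = n div 2"
    by blast
  define k where "k = n div 4"
  have "n mod 8 = 4"
    using assms(2) by (simp add: cong_def)
  then have "n = 4 * k" "odd k"
    unfolding k_def by presburger+
  with coil_count_ge[OF p(1)] p(2) show False
    by simp
qed

end
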